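(* Let $p>5$ be a prime. Then $$\sum_{k=0}^{[p/4]}\frac{\binom{4k}{2k}}{(-64)^k}\equiv\begin{cases}(-1)^{[\frac{p+5}{10}]}5^{[\frac p4]}\pmod p&\text{if }p\equiv1,3,7,9\pmod{20},\\ 2(-1)^{[\frac{p+5}{10}]}5^{\frac{p-3}4}\pmod p&\text{if }p\equiv11,19\pmod{20},\\ 0\pmod p&\text{if }p\equiv13,17\pmod{20}\end{cases}$$ and $$\sum_{k=0}^{[p/4]}\frac{\binom{4k}{2k}}{(-4)^k}\equiv\begin{cases}(-1)^{[\frac{p+5}{10}]}5^{[\frac p4]}\pmod p&\text{if }p\equiv1,9,11,19\pmod{20},\\ -2(-1)^{[\frac{p+5}{10}]}5^{\frac{p-3}4}\pmod p&\text{if }p\equiv3,7\pmod{20},\\ 0\pmod p&\text{if }p\equiv13,17\pmod{20}.\end{cases}$$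
   Context: $[x]$ is the greatest integer not exceeding $x$. *)

theory Defs
  imports Complex_Main "HOL-Number_Theory.Number_Theory"
begin

text \<open>For prime \<open>p\<close> this is the localisation of the integers at \<open>(p)\<close>,
  as a subring of the rationals.\<close>

definition p_integers :: "nat \<Rightarrow> rat set" where
  "p_integers p = {of_int a / of_int b | a b :: int. \<not> int p dvd b}"

text \<open>Both sides are required to be \<open>p\<close>-integral, so that the congruence is one in the ring
  of \<open>p\<close>-integral rationals modulo its ideal generated by \<open>p\<close>.\<close>

definition rat_cong :: "nat \<Rightarrow> rat \<Rightarrow> rat \<Rightarrow> bool" where
  "rat_cong p x y \<longleftrightarrow>
     x \<in> p_integers p \<and> y \<in> p_integers p \<and> (\<exists>z \<in> p_integers p. x - y = of_nat p * z)"

end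

theory Submission
  imports Defs "HOL-Computational_Algebra.Polynomial"
begin

text \<open>Let \<open>n = (p - 1)/2\<close>. Since \<open>n\<close> is congruent to \<open>-1/2\<close>, the central binomial
  coefficient \<open>4k choose 2k\<close> is congruent to \<open>16\<^sup>k (n choose 2k)\<close>, so that the two sums are
  congruent to the real parts of \<open>(1 + 2i)\<^sup>n\<close> (denominators \<open>(-4)\<^sup>k\<close>) and \<open>(4 + 2i)\<^sup>n\<close>
  (denominators \<open>(-64)\<^sup>k\<close>). Up to squares in the ring of integers of the 20th cyclotomic field,
  \<open>1 + 2i\<close> equals \<open>- \<surd>5\<close> and \<open>4 + 2i\<close> equals \<open>1 - 2i\<close>; the \<open>n\<close>-th powers of the
  squares involved are \<open>(p - 1)\<close>-th powers and hence are known from the Frobenius map, which only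
  depends on \<open>p mod 20\<close>.\<close>

section \<open>Congruences in the 20th cyclotomic ring modulo p\<close>

text \<open>The cyclotomic ring is represented by integer polynomials in \<open>zeta\<close> modulo the 20th
  cyclotomic polynomial.\<close>

definition zeta :: "int poly" where "zeta = [:0, 1:]"

definition Phi20 :: "int poly" where
  "Phi20 = zeta ^ 8 - zeta ^ 6 + zeta ^ 4 - zeta ^ 2 + 1"

text \<open>The quotient by the ideal generated by \<open>p\<close> and \<open>Phi20\<close> may
  have zero divisors, so later cancellations go through integers coprime to
  \<open>p\<close>.\<close>

definition cyc_cong :: "nat \<Rightarrow> int poly \<Rightarrow> int poly \<Rightarrow> bool" where
  "cyc_cong p a b \<longleftrightarrow> (\<exists>u v. a - b = of_nat p * u + Phi20 * v)"

text \<open>Reduces an identity between cyclotomic integers to a membership in the ideal of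
  \<open>Phi20\<close>, which a Groebner basis computation settles independently of
  \<open>p\<close>.\<close>

lemma cyc_cong_Phi20I: "\<exists>v. a - b = Phi20 * v \<Longrightarrow> cyc_cong p a b"
  unfolding cyc_cong_def by (metis mult_zero_right add_0)

lemma cyc_cong_refl [simp]: "cyc_cong p a a"
  unfolding cyc_cong_def by (intro exI[of _ 0]) simp

lemma cyc_cong_sym: "cyc_cong p a b \<Longrightarrow> cyc_cong p b a"
  unfolding cyc_cong_def
proof (elim exE)
  fix u v assume "a - b = of_nat p * u + Phi20 * v"
  then have "b - a = of_nat p * (- u) + Phi20 * (- v)" by Groebner_Basis.algebra
  then show "\<exists>u v. b - a = of_nat p * u + Phi20 * v" by blast
qed

lemma cyc_cong_add:
  assumes "cyc_cong p a b" "cyc_cong p c d"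
  shows "cyc_cong p (a + c) (b + d)"
proof -
  obtain u v u' v' where "a - b = of_nat p * u + Phi20 * v" "c - d = of_nat p * u' + Phi20 * v'"
    using assms unfolding cyc_cong_def by blast
  then have "a + c - (b + d) = of_nat p * (u + u') + Phi20 * (v + v')" by Groebner_Basis.algebra
  then show ?thesis unfolding cyc_cong_def by blast
qed

lemma cyc_cong_trans [trans]:
  assumes "cyc_cong p a b" "cyc_cong p b c"
  shows "cyc_cong p a c"
  \<comment> \<open>In \<open>(a + b) - (b + c)\<close> the middle term cancels.\<close>
  using cyc_cong_add[OF assms] unfolding cyc_cong_def by (simp add: algebra_simps)

lemma cyc_cong_mult:
  assumes "cyc_cong p a b" "cyc_cong p c d"
  shows "cyc_cong p (a * c) (b * d)"
proof -
  obtain u v u' v' where "a - b = of_nat p * u + Phi20 * v" "c - d = of_nat p * u' + Phi20 * v'"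
    using assms unfolding cyc_cong_def by blast
  then have "a * c - b * d = of_nat p * (u * c + b * u') + Phi20 * (v * c + b * v')" by Groebner_Basis.algebra
  then show ?thesis unfolding cyc_cong_def by blast
qed

lemma cyc_cong_uminus: "cyc_cong p a b \<Longrightarrow> cyc_cong p (- a) (- b)"
  using cyc_cong_mult[of p "- 1" "- 1"] by simp

lemma cyc_cong_diff:
  "cyc_cong p a b \<Longrightarrow> cyc_cong p c d \<Longrightarrow> cyc_cong p (a - c) (b - d)"
  using cyc_cong_add[OF _ cyc_cong_uminus] by fastforce

lemma cyc_cong_power: "cyc_cong p a b \<Longrightarrow> cyc_cong p (a ^ n) (b ^ n)"
  by (induction n) (simp_all add: cyc_cong_mult)

lemma cyc_cong_sum:
  "(\<And>i. i \<in> I \<Longrightarrow> cyc_cong p (f i) (g i)) \<Longrightarrow> cyc_cong p (\<Sum>i\<in>I. f i) (\<Sum>i\<in>I. g i)"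
  by (induction I rule: infinite_finite_induct) (simp_all add: cyc_cong_add)

lemma of_int_poly_int: "(of_int c :: int poly) = [:c:]"
  by (simp add: of_int_poly)

lemma degree_Phi20: "degree Phi20 = 8" and lead_coeff_Phi20: "coeff Phi20 8 = 1"
proof -
  have "Phi20 = [:1, 0, -1, 0, 1, 0, -1, 0, 1:]"
    unfolding Phi20_def zeta_def by (simp add: power_numeral_reduce one_pCons)
  note Phi20 = this
  show "degree Phi20 = 8" unfolding Phi20 by simp
  show "coeff Phi20 8 = 1" unfolding Phi20 by (simp add: eval_nat_numeral)
qed

text \<open>The powers \<open>1, \<zeta>, \<dots>, \<zeta>\<^sup>7\<close> are a basis modulo the
  monic polynomial of degree 8, so coefficients of 1 and \<open>\<zeta>\<^sup>5\<close> may be compared.\<close>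

lemma cyc_cong_Gaussian_zeroD:
  assumes "cyc_cong p (of_int a + of_int b * zeta ^ 5) 0"
  shows "int p dvd a" "int p dvd b"
proof -
  define g where "g = (of_int a + of_int b * zeta ^ 5 :: int poly)"
  have g: "g = [:a, 0, 0, 0, 0, b:]"
    unfolding g_def zeta_def by (simp add: power_numeral_reduce of_int_poly_int)
  obtain u v where uv: "g = of_nat p * u + Phi20 * v"
    using assms unfolding cyc_cong_def g_def by auto
  have nz: "Phi20 \<noteq> 0" using degree_Phi20 by auto
  \<comment> \<open>\<open>Phi20\<close> is monic, so pseudo-division over the integers is true
    division. With \<open>u\<close> reduced to \<open>r\<close>, a multiple of \<open>Phi20\<close>
    of degree below 8 remains, which must vanish.\<close>
  obtain q r where "pseudo_divmod u Phi20 = (q, r)" by fastforce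
  from pseudo_divmod[OF nz this]
  have qr: "u = Phi20 * q + r" "r = 0 \<or> degree r < 8"
    by (simp_all add: degree_Phi20 lead_coeff_Phi20)
  have eq: "g - smult (int p) r = Phi20 * (smult (int p) q + v)"
    using uv qr(1) by (simp add: of_nat_poly algebra_simps smult_add_right)
  have "degree g < 8" unfolding g by simp
  moreover have "degree (smult (int p) r) < 8" using qr(2) by (auto intro: le_less_trans)
  ultimately have "degree (g - smult (int p) r) < 8" by (rule degree_diff_less)
  moreover have "8 \<le> degree (Phi20 * t)" if "t \<noteq> 0" for t
    using that nz by (simp add: degree_mult_eq degree_Phi20)
  ultimately have "g - smult (int p) r = 0"
    unfolding eq by (metis mult_zero_right not_less)
  then have "g = smult (int p) r" by simp
  then have "coeff g 0 = int p * coeff r 0" "coeff g 5 = int p * coeff r 5" by simp_all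
  then show "int p dvd a" "int p dvd b"
    unfolding g by (simp_all add: eval_nat_numeral)
qed

section \<open>The Frobenius map and powers of zeta\<close>

lemma freshman_dream_dvd:
  fixes a b :: "'a::comm_ring_1"
  assumes "prime p"
  shows "of_nat p dvd (a + b) ^ p - (a ^ p + b ^ p)"
proof -
  let ?t = "\<lambda>k. of_nat (p choose k) * a ^ k * b ^ (p - k)"
  have p: "p > 0" using assms by (rule prime_gt_0_nat)
  have "{..p} = insert 0 (insert p {0<..<p})" using p by auto
  then have "(a + b) ^ p = ?t 0 + (?t p + (\<Sum>k\<in>{0<..<p}. ?t k))"
    unfolding binomial_ring using p by simp
  then have "(a + b) ^ p - (a ^ p + b ^ p) = (\<Sum>k\<in>{0<..<p}. ?t k)" by simp
  moreover have "of_nat p dvd ?t k" if k: "k \<in> {0<..<p}" for k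
  proof -
    have "p dvd p choose k" using that assms p by (intro dvd_choose_prime) auto
    then have "(of_nat p :: 'a) dvd of_nat (p choose k)" by (auto elim!: dvdE)
    then show ?thesis by (simp add: dvd_mult2)
  qed
  ultimately show ?thesis by (metis (no_types, lifting) dvd_sum)
qed

lemma cyc_cong_Frobenius_add:
  assumes "prime p"
  shows "cyc_cong p ((a + b) ^ p) (a ^ p + b ^ p)"
proof -
  obtain u where "(a + b) ^ p - (a ^ p + b ^ p) = of_nat p * u"
    using freshman_dream_dvd[OF assms] by blast
  then have "(a + b) ^ p - (a ^ p + b ^ p) = of_nat p * u + Phi20 * 0" by simp
  then show ?thesis unfolding cyc_cong_def by blast
qed

lemma cyc_cong_Frobenius_diff:
  assumes "prime p"
  shows "cyc_cong p ((a - b) ^ p) (a ^ p - b ^ p)"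
proof -
  \<comment> \<open>Additivity is applied to \<open>(a - b) + b\<close>, which avoids the sign of
    \<open>(- b) ^ p\<close>.\<close>
  have "cyc_cong p (a ^ p - b ^ p) ((a - b) ^ p + b ^ p - b ^ p)"
    using cyc_cong_Frobenius_add[OF assms, of "a - b" b] by (intro cyc_cong_diff) auto
  then show ?thesis by (simp add: cyc_cong_sym)
qed

text \<open>Since \<open>Phi20 * (zeta ^ 2 + 1) = zeta ^ 10 + 1\<close>, the power
  \<open>zeta ^ 10\<close> is -1.\<close>

lemma cyc_cong_zeta_power: "cyc_cong p (zeta ^ (10 * k + j)) ((- 1) ^ k * zeta ^ j)"
proof -
  have "cyc_cong p (zeta ^ 10) (- 1)"
    by (rule cyc_cong_Phi20I, unfold Phi20_def) Groebner_Basis.algebra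
  then show ?thesis
    unfolding power_add power_mult by (intro cyc_cong_mult cyc_cong_power) auto
qed

lemma cyc_cong_zeta_power_mod:
  assumes "k mod 20 = j"
  shows "cyc_cong p (zeta ^ k) (zeta ^ j)"
proof -
  have "k = 10 * (2 * (k div 20)) + j" using assms by presburger
  then show ?thesis using cyc_cong_zeta_power[of p "2 * (k div 20)" j] by simp
qed

section \<open>Powers of Gaussian integers\<close>

text \<open>Real part of (c + di)^n by the binomial theorem; \<open>gauss_im\<close> is the
  imaginary part. Both run over all \<open>j \<le> n\<close> with a parity test, so that they
  recombine term by term.\<close>

definition gauss_re :: "int \<Rightarrow> int \<Rightarrow> nat \<Rightarrow> int" where
  "gauss_re c d n = (\<Sum>j\<le>n. if even j
     then int (n choose j) * d ^ j * c ^ (n - j) * (- 1) ^ (j div 2) else 0)"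

definition gauss_im :: "int \<Rightarrow> int \<Rightarrow> nat \<Rightarrow> int" where
  "gauss_im c d n = (\<Sum>j\<le>n. if even j then 0
     else int (n choose j) * d ^ j * c ^ (n - j) * (- 1) ^ (j div 2))"

lemma gauss_re_uminus: "gauss_re c (- d) n = gauss_re c d n"
  unfolding gauss_re_def by (intro sum.cong) auto

lemma gauss_im_uminus: "gauss_im c (- d) n = - gauss_im c d n"
  unfolding gauss_im_def sum_negf[symmetric] by (intro sum.cong) auto

text \<open>With j = 2k the real part takes the shape of the two binomial sums.\<close>

lemma gauss_re_eq:
  "gauss_re c d n = (\<Sum>k=0..n div 2. int (n choose (2 * k)) * d ^ (2 * k) * c ^ (n - 2 * k) * (- 1) ^ k)"
proof -
  have "gauss_re c d n = (\<Sum>j | j \<in> {..n} \<and> even j.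
      int (n choose j) * d ^ j * c ^ (n - j) * (- 1) ^ (j div 2))"
    unfolding gauss_re_def by (rule sum.inter_filter[symmetric]) simp
  also have "\<dots> = (\<Sum>k=0..n div 2. int (n choose (2 * k)) * d ^ (2 * k) * c ^ (n - 2 * k) * (- 1) ^ k)"
    by (rule sum.reindex_bij_witness[of _ "\<lambda>k. 2 * k" "\<lambda>j. j div 2"]) auto
  finally show ?thesis .
qed

text \<open>Here \<open>zeta ^ 5\<close> serves as i, its square \<open>zeta ^ 10\<close> being
  -1.\<close>

lemma cyc_cong_gauss_power:
  "cyc_cong p ((of_int c + of_int d * zeta ^ 5) ^ n)
     (of_int (gauss_re c d n) + of_int (gauss_im c d n) * zeta ^ 5)"
proof -
  let ?r = "\<lambda>j. int (n choose j) * d ^ j * c ^ (n - j)"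
  let ?y = "\<lambda>j. (- 1) ^ (j div 2) * (if even j then 1 else zeta ^ 5)"
  have y: "cyc_cong p (zeta ^ (5 * j)) (?y j)" for j
  proof (cases "even j")
    case True
    then obtain k where "j = 2 * k" by (elim evenE)
    then show ?thesis using cyc_cong_zeta_power[of p k 0] by simp
  next
    case False
    then have "5 * j = 10 * (j div 2) + 5" by presburger
    then show ?thesis using cyc_cong_zeta_power[of p "j div 2" 5] False by simp
  qed
  have "(of_int c + of_int d * zeta ^ 5) ^ n = (\<Sum>j\<le>n. of_int (?r j) * zeta ^ (5 * j))"
    unfolding add.commute[of "of_int c"] binomial_ring
    by (intro sum.cong) (simp_all add: power_mult_distrib mult_ac flip: power_mult)
  also have "cyc_cong p \<dots> (\<Sum>j\<le>n. of_int (?r j) * ?y j)"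
    by (intro cyc_cong_sum cyc_cong_mult y) simp
  also have "(\<Sum>j\<le>n. of_int (?r j) * ?y j)
      = of_int (gauss_re c d n) + of_int (gauss_im c d n) * zeta ^ 5"
    unfolding gauss_re_def gauss_im_def of_int_sum sum_distrib_right sum.distrib[symmetric]
    by (intro sum.cong) auto
  finally show ?thesis .
qed

text \<open>The factor \<open>k\<close> leaves room for the multipliers 5 and 2 that arise when
  cyclotomic factors are cleared below.\<close>

lemma cyc_cong_GaussianD:
  assumes "cyc_cong p (of_int k * (of_int a + of_int b * zeta ^ 5))
             (of_int k * (of_int c + of_int d * zeta ^ 5))"
    and "coprime k (int p)"
  shows "[a = c] (mod int p)" "[b = d] (mod int p)"
proof -
  have "cyc_cong p (of_int (k * (a - c)) + of_int (k * (b - d)) * zeta ^ 5) 0"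
    using cyc_cong_diff[OF assms(1) cyc_cong_refl[of p "of_int k * (of_int c + of_int d * zeta ^ 5)"]]
    by (simp add: algebra_simps)
  from cyc_cong_Gaussian_zeroD[OF this] show "[a = c] (mod int p)" "[b = d] (mod int p)"
    using assms(2) by (simp_all add: cong_iff_dvd_diff coprime_commute coprime_dvd_mult_right_iff)
qed

section \<open>The powers of 1 + 2i and 4 + 2i\<close>

text \<open>Modulo \<open>Phi20\<close> put \<open>i = \<zeta>\<^sup>5\<close>, \<open>D = \<zeta>\<^sup>4 + \<zeta>\<^sup>6 = \<zeta>\<^sub>5 - \<zeta>\<^sub>5\<^bsup>-1\<^esup>\<close>,
  \<open>\<epsilon> = 1 + \<zeta>\<^sup>4 - \<zeta>\<^sup>6 = (1 + \<surd>5)/2\<close> and \<open>s = 2\<epsilon> - 1 = \<surd>5\<close>. The identity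
  \<open>(1 + 2i) D\<^sup>2 = - s (\<epsilon> + i)\<^sup>2\<close> raised to the power \<open>n = (p - 1)/2\<close> expresses
  \<open>(1 + 2i)\<^sup>n\<close> by the Frobenius images of \<open>D\<close> and \<open>\<epsilon> + i\<close>.\<close>

lemma gauss_1_2_cong:
  fixes p n r t e4 e5 e6 :: nat and a b :: int and K :: "int poly"
  defines "D \<equiv> zeta ^ 4 + zeta ^ 6" and "E \<equiv> 1 + zeta ^ 4 + zeta ^ 5 - zeta ^ 6"
    and "s \<equiv> 1 + 2 * zeta ^ 4 - 2 * zeta ^ 6"
  assumes p: "prime p" "p > 5" "p = 2 * n + 1" and r: "p mod 20 = r" "r mod 4 = 2 * t + 1"
    and er: "4 * r mod 20 = e4" "5 * r mod 20 = e5" "6 * r mod 20 = e6"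
    and id: "\<exists>v. (1 + zeta ^ e4 + zeta ^ e5 - zeta ^ e6) * D * (- s) ^ t
      - (of_int a + of_int b * zeta ^ 5) * ((zeta ^ e4 + zeta ^ e6) * E) = Phi20 * v"
    and K: "\<exists>v. K * ((zeta ^ e4 + zeta ^ e6) * E) - 5 = Phi20 * v"
  shows "[gauss_re 1 2 n = a * 5 ^ (p div 4)] (mod int p) \<and>
    [gauss_im 1 2 n = b * 5 ^ (p div 4)] (mod int p)"
proof -
  define m where "m = p div 4"
  have "p mod 20 mod 4 = p mod 4" by (simp add: mod_mod_cancel)
  then have "p mod 4 = 2 * t + 1" using r by simp
  \<comment> \<open>So \<open>t\<close> is the parity of \<open>n\<close>, and
    \<open>s ^ 2 = 5\<close> turns \<open>(- s) ^ n\<close> into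
    \<open>5 ^ m * (- s) ^ t\<close>.\<close>
  then have n: "n = 2 * m + t"
    using p(3) mult_div_mod_eq[of 4 p] unfolding m_def by linarith
  have e: "4 * p mod 20 = e4" "5 * p mod 20 = e5" "6 * p mod 20 = e6"
    using er unfolding r(1)[symmetric] by (simp_all only: mod_mult_right_eq)
  define W where "W = (1 + 2 * zeta ^ 5) ^ n"
  \<comment> \<open>Frobenius sends \<open>zeta ^ k\<close> to \<open>zeta ^ (k * p)\<close>;
    \<open>D'\<close> and \<open>E'\<close> are the images of \<open>D\<close> and
    \<open>E\<close>.\<close>
  define D' where "D' = zeta ^ e4 + zeta ^ e6"
  define E' where "E' = 1 + zeta ^ e4 + zeta ^ e5 - zeta ^ e6"
  define w where "w = (of_int a + of_int b * zeta ^ 5 :: int poly)"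
  have z: "cyc_cong p ((zeta ^ k) ^ p) (zeta ^ j)" if "k * p mod 20 = j" for k j
    using cyc_cong_zeta_power_mod[OF that] by (simp add: power_mult)
  have D: "cyc_cong p (D ^ p) D'"
    unfolding D_def D'_def
    by (rule cyc_cong_trans[OF cyc_cong_Frobenius_add[OF p(1)]]) (intro cyc_cong_add z e)
  have "cyc_cong p (E ^ p) ((1 + zeta ^ 4 + zeta ^ 5) ^ p - (zeta ^ 6) ^ p)"
    unfolding E_def by (rule cyc_cong_Frobenius_diff[OF p(1)])
  also have "cyc_cong p \<dots> ((1 + zeta ^ 4) ^ p + (zeta ^ 5) ^ p - (zeta ^ 6) ^ p)"
    by (intro cyc_cong_diff cyc_cong_Frobenius_add p cyc_cong_refl)
  also have "cyc_cong p \<dots> (1 ^ p + (zeta ^ 4) ^ p + (zeta ^ 5) ^ p - (zeta ^ 6) ^ p)"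
    by (intro cyc_cong_diff cyc_cong_add cyc_cong_Frobenius_add p cyc_cong_refl)
  also have "cyc_cong p \<dots> E'"
    unfolding E'_def by (intro cyc_cong_diff cyc_cong_add z e) simp
  finally have E: "cyc_cong p (E ^ p) E'" .
  have "cyc_cong p ((1 + 2 * zeta ^ 5) * D ^ 2) (- s * E ^ 2)"
    by (rule cyc_cong_Phi20I, unfold Phi20_def D_def E_def s_def) Groebner_Basis.algebra
  then have "cyc_cong p (((1 + 2 * zeta ^ 5) * D ^ 2) ^ n) ((- s * E ^ 2) ^ n)"
    by (rule cyc_cong_power)
  \<comment> \<open>The extra factor \<open>D * E\<close> completes the exponents 2n to p = 2n + 1,
    so that Frobenius applies.\<close>
  then have "cyc_cong p (((1 + 2 * zeta ^ 5) * D ^ 2) ^ n * (D * E)) ((- s * E ^ 2) ^ n * (D * E))"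
    by (intro cyc_cong_mult) simp_all
  moreover have "x ^ p = (x ^ 2) ^ n * x" for x :: "int poly"
    unfolding p(3) by (simp add: power_mult)
  ultimately have key: "cyc_cong p (W * D ^ p * E) ((- s) ^ n * E ^ p * D)"
    unfolding W_def by (simp only: power_mult_distrib mult_ac)
  have "cyc_cong p ((- s) ^ 2) 5"
    by (rule cyc_cong_Phi20I, unfold Phi20_def s_def) Groebner_Basis.algebra
  then have s: "cyc_cong p ((- s) ^ n) (5 ^ m * (- s) ^ t)"
    unfolding n power_add power_mult by (intro cyc_cong_mult cyc_cong_power) simp_all
  have "cyc_cong p (W * D' * E) (W * D ^ p * E)"
    by (intro cyc_cong_mult cyc_cong_sym[OF D]) simp_all
  also note key
  also have "cyc_cong p ((- s) ^ n * E ^ p * D) (5 ^ m * (- s) ^ t * E' * D)"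
    by (intro cyc_cong_mult s E) simp
  also have "5 ^ m * (- s) ^ t * E' * D = 5 ^ m * (E' * D * (- s) ^ t)"
    by (simp only: mult_ac)
  also have "cyc_cong p \<dots> (5 ^ m * (w * (D' * E)))"
    using id unfolding w_def[symmetric] D'_def[symmetric] E'_def[symmetric]
    by (intro cyc_cong_mult cyc_cong_Phi20I) simp_all
  finally have c: "cyc_cong p (W * D' * E) (5 ^ m * (w * (D' * E)))" .
  have K: "cyc_cong p (K * (D' * E)) 5"
    using K unfolding D'_def[symmetric] by (rule cyc_cong_Phi20I)
  \<comment> \<open>Multiplication by \<open>K\<close> turns the common factor \<open>D' * E\<close>
    of \<open>c\<close> into 5, which is invertible modulo \<open>p\<close>.\<close>
  have "cyc_cong p (5 * (of_int (gauss_re 1 2 n) + of_int (gauss_im 1 2 n) * zeta ^ 5)) (5 * W)"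
    using cyc_cong_gauss_power[of p 1 2 n] unfolding W_def
    by (intro cyc_cong_mult cyc_cong_sym[of p "_ ^ n"]) simp_all
  also have "cyc_cong p (5 * W) (K * (D' * E) * W)"
    by (intro cyc_cong_mult cyc_cong_sym[OF K]) simp
  also have "K * (D' * E) * W = K * (W * D' * E)" by (simp only: mult_ac)
  also have "cyc_cong p \<dots> (K * (5 ^ m * (w * (D' * E))))"
    by (intro cyc_cong_mult c) simp
  also have "\<dots> = K * (D' * E) * (5 ^ m * w)" by (simp only: mult_ac)
  also have "cyc_cong p \<dots> (5 * (5 ^ m * w))"
    by (intro cyc_cong_mult K) simp_all
  also have "5 ^ m * w = of_int (a * 5 ^ m) + of_int (b * 5 ^ m) * zeta ^ 5"
    unfolding w_def by (simp add: algebra_simps)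
  finally have *: "cyc_cong p (of_int 5 * (of_int (gauss_re 1 2 n) + of_int (gauss_im 1 2 n) * zeta ^ 5))
      (of_int 5 * (of_int (a * 5 ^ m) + of_int (b * 5 ^ m) * zeta ^ 5))" by simp
  have "coprime p 5"
    using p(1,2) by (intro primes_coprime) auto
  then have "coprime (5::int) (int p)"
    by (metis coprime_commute coprime_int_iff of_nat_numeral)
  from cyc_cong_GaussianD[OF * this] show ?thesis
    unfolding m_def ..
qed

text \<open>With \<open>i = \<zeta>\<^sup>5\<close>, the factor \<open>(1 + i)\<^sup>2\<close> of \<open>4 + 2i = (1 + i)\<^sup>2 (1 - 2i)\<close> contributes
  \<open>(1 + i)\<^bsup>p-1\<^esup>\<close>, which is congruent to 1 or \<open>-i\<close>.\<close>

lemma gauss_re_4_2_cong: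
  fixes p n :: nat
  assumes p: "prime p" "p > 2" "p = 2 * n + 1"
  shows "p mod 4 = 1 \<Longrightarrow> [gauss_re 4 2 n = gauss_re 1 2 n] (mod int p)"
    and "p mod 4 = 3 \<Longrightarrow> [gauss_re 4 2 n = - gauss_im 1 2 n] (mod int p)"
proof -
  define A B where "A = gauss_re 1 2 n" and "B = gauss_im 1 2 n"
  define y where "y = zeta ^ 5"
  have "coprime p 2"
    using p(1,2) by (intro primes_coprime) auto
  then have cop: "coprime (2::int) (int p)"
    by (metis coprime_commute coprime_int_iff of_nat_numeral)
  have "cyc_cong p ((1 - 2 * y) ^ n) (of_int A - of_int B * y)"
    using cyc_cong_gauss_power[of p 1 "- 2" n]
    unfolding A_def B_def y_def by (simp add: gauss_re_uminus gauss_im_uminus)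
  note AB = this
  have two: "cyc_cong p ((1 - y) * (1 + y)) 2"
    by (rule cyc_cong_Phi20I, unfold Phi20_def y_def) Groebner_Basis.algebra
  have "cyc_cong p (2 * (of_int (gauss_re 4 2 n) + of_int (gauss_im 4 2 n) * y)) (2 * (4 + 2 * y) ^ n)"
    using cyc_cong_gauss_power[of p 4 2 n] unfolding y_def
    by (intro cyc_cong_mult cyc_cong_sym[of p "_ ^ n"]) simp_all
  \<comment> \<open>The 2 is spent as \<open>(1 - y) * (1 + y)\<close>: the spare
    \<open>1 + y\<close> completes \<open>((1 + y) ^ 2) ^ n\<close> to
    \<open>(1 + y) ^ p\<close>.\<close>
  also have "cyc_cong p \<dots> ((1 - y) * (1 + y) * (((1 + y) ^ 2 * (1 - 2 * y)) ^ n))"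
  proof (intro cyc_cong_mult cyc_cong_power cyc_cong_sym[OF two])
    show "cyc_cong p (4 + 2 * y) ((1 + y) ^ 2 * (1 - 2 * y))"
      by (rule cyc_cong_Phi20I, unfold Phi20_def y_def) Groebner_Basis.algebra
  qed
  also have "\<dots> = (1 - y) * (1 + y) ^ p * (1 - 2 * y) ^ n"
  proof -
    have "(1 + y) ^ p = ((1 + y) ^ 2) ^ n * (1 + y)"
      unfolding p(3) by (simp add: power_mult)
    then show ?thesis by (simp only: power_mult_distrib mult_ac)
  qed
  also have "cyc_cong p \<dots> ((1 - y) * (1 ^ p + y ^ p) * (of_int A - of_int B * y))"
    by (intro cyc_cong_mult AB cyc_cong_Frobenius_add p(1)) simp
  finally have *: "cyc_cong p (2 * (of_int (gauss_re 4 2 n) + of_int (gauss_im 4 2 n) * y))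
     ((1 - y) * (1 ^ p + y ^ p) * (of_int A - of_int B * y))" .
  show "[gauss_re 4 2 n = A] (mod int p)" if "p mod 4 = 1"
  proof -
    have "5 * p mod 20 = 5" using that mult_mod_right[of 5 p 4] by simp
    then have "cyc_cong p (y ^ p) y"
      using cyc_cong_zeta_power_mod unfolding y_def power_mult[symmetric] by blast
    then have "cyc_cong p ((1 - y) * (1 ^ p + y ^ p)) ((1 - y) * (1 + y))"
      by (intro cyc_cong_mult cyc_cong_add) simp_all
    also note two
    finally have "cyc_cong p ((1 - y) * (1 ^ p + y ^ p) * (of_int A - of_int B * y))
        (2 * (of_int A - of_int B * y))"
      by (rule cyc_cong_mult) simp
    from cyc_cong_trans[OF * this]
    have "cyc_cong p (of_int 2 * (of_int (gauss_re 4 2 n) + of_int (gauss_im 4 2 n) * zeta ^ 5))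
        (of_int 2 * (of_int A + of_int (- B) * zeta ^ 5))"
      unfolding y_def by simp
    then show ?thesis using cop by (rule cyc_cong_GaussianD)
  qed
  show "[gauss_re 4 2 n = - B] (mod int p)" if "p mod 4 = 3"
  proof -
    have "5 * p mod 20 = 15" using that mult_mod_right[of 5 p 4] by simp
    then have "cyc_cong p (y ^ p) (zeta ^ 15)"
      using cyc_cong_zeta_power_mod unfolding y_def power_mult[symmetric] by blast
    then have "cyc_cong p ((1 - y) * (1 ^ p + y ^ p) * (of_int A - of_int B * y))
        ((1 - y) * (1 + zeta ^ 15) * (of_int A - of_int B * y))"
      by (intro cyc_cong_mult cyc_cong_add) simp_all
    \<comment> \<open>\<open>zeta ^ 15\<close> is -i, and (1 - i)^2 (A - Bi) = -2i (A - Bi) = 2(-B -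
      Ai).\<close>
    also have "cyc_cong p \<dots> (2 * (- of_int B + (- of_int A) * y))"
      by (rule cyc_cong_Phi20I, unfold Phi20_def y_def) Groebner_Basis.algebra
    finally have "cyc_cong p ((1 - y) * (1 ^ p + y ^ p) * (of_int A - of_int B * y))
      (2 * (- of_int B + (- of_int A) * y))" .
    from cyc_cong_trans[OF * this]
    have "cyc_cong p (of_int 2 * (of_int (gauss_re 4 2 n) + of_int (gauss_im 4 2 n) * zeta ^ 5))
        (of_int 2 * (of_int (- B) + of_int (- A) * zeta ^ 5))"
      unfolding y_def by simp
    then show ?thesis using cop by (rule cyc_cong_GaussianD)
  qed
qed

text \<open>The table runs over the residues coprime to 20; a + bi is the quotient of
  \<open>E' * D * (- s) ^ t\<close> by \<open>D' * E\<close> in the notation of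
  \<open>gauss_1_2_cong\<close>.\<close>

lemma gauss_1_2_cong_mod_20:
  fixes p n :: nat and a b :: int
  assumes p: "prime p" "p > 5" "p = 2 * n + 1"
    and r: "(p mod 20, a, b) \<in> {(1, 1, 0), (3, -2, -1), (7, 2, 1), (9, -1, 0),
      (11, -1, 2), (13, 0, -1), (17, 0, 1), (19, 1, -2)}"
  shows "[gauss_re 1 2 n = a * 5 ^ (p div 4)] (mod int p) \<and>
    [gauss_im 1 2 n = b * 5 ^ (p div 4)] (mod int p)" (is "?P a b")
proof -
  \<comment> \<open>\<open>?K\<close> and \<open>?L\<close> are 5 times the inverses of \<open>(\<zeta>\<^sup>4 + \<zeta>\<^sup>6)(\<epsilon> + i)\<close> and \<open>(\<zeta>\<^sup>8 + \<zeta>\<^sup>2)(\<epsilon> + i)\<close>.\<close>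
  let ?K = "1 - 2 * zeta - 2 * zeta ^ 2 + 2 * zeta ^ 3 + zeta ^ 4 - zeta ^ 5 - zeta ^ 6"
  let ?L = "zeta ^ 7 - zeta ^ 6 - zeta ^ 4 - zeta ^ 3"
  note of_int = of_int_minus of_int_numeral of_int_1 of_int_0
  note power = power_0 power_one_right
  have "?P 1 0" if "p mod 20 = 1"
    by (rule gauss_1_2_cong[OF p that, where t = 0 and ?e4.0 = 4 and ?e5.0 = 5 and ?e6.0 = 6 and K = ?K],
        simp, simp, simp, simp, rule exI[of _ 0], simp, unfold Phi20_def, Groebner_Basis.algebra)
  \<comment> \<open>As \<open>zeta ^ 10\<close> is -1, the image of
    \<open>zeta ^ 4 + zeta ^ 6\<close> is, up to sign, itself or \<open>zeta ^ 8 + zeta ^ 2\<close>;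
    this decides between \<open>?K\<close> and \<open>?L\<close> and fixes the sign.\<close>
  moreover have "?P (- 2) (- 1)" if "p mod 20 = 3"
    by (rule gauss_1_2_cong[OF p that, where t = 1 and ?e4.0 = 12 and ?e5.0 = 15 and ?e6.0 = 18 and K = "- ?L"],
        simp, simp, simp, simp, unfold Phi20_def of_int power, Groebner_Basis.algebra+)
  moreover have "?P 2 1" if "p mod 20 = 7"
    by (rule gauss_1_2_cong[OF p that, where t = 1 and ?e4.0 = 8 and ?e5.0 = 15 and ?e6.0 = 2 and K = ?L],
        simp, simp, simp, simp, unfold Phi20_def of_int power, Groebner_Basis.algebra+)
  moreover have "?P (- 1) 0" if "p mod 20 = 9"
    by (rule gauss_1_2_cong[OF p that, where t = 0 and ?e4.0 = 16 and ?e5.0 = 5 and ?e6.0 = 14 and K = "- ?K"],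
        simp, simp, simp, simp, unfold Phi20_def of_int power, Groebner_Basis.algebra+)
  moreover have "?P (- 1) 2" if "p mod 20 = 11"
    by (rule gauss_1_2_cong[OF p that, where t = 1 and ?e4.0 = 4 and ?e5.0 = 15 and ?e6.0 = 6 and K = ?K],
        simp, simp, simp, simp, unfold Phi20_def of_int power, Groebner_Basis.algebra+)
  moreover have "?P 0 (- 1)" if "p mod 20 = 13"
    by (rule gauss_1_2_cong[OF p that, where t = 0 and ?e4.0 = 12 and ?e5.0 = 5 and ?e6.0 = 18 and K = "- ?L"],
        simp, simp, simp, simp, unfold Phi20_def of_int power, Groebner_Basis.algebra+)
  moreover have "?P 0 1" if "p mod 20 = 17"
    by (rule gauss_1_2_cong[OF p that, where t = 0 and ?e4.0 = 8 and ?e5.0 = 5 and ?e6.0 = 2 and K = ?L],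
        simp, simp, simp, simp, unfold Phi20_def of_int power, Groebner_Basis.algebra+)
  moreover have "?P 1 (- 2)" if "p mod 20 = 19"
    by (rule gauss_1_2_cong[OF p that, where t = 1 and ?e4.0 = 16 and ?e5.0 = 15 and ?e6.0 = 14 and K = "- ?K"],
        simp, simp, simp, simp, unfold Phi20_def of_int power, Groebner_Basis.algebra+)
  ultimately show ?thesis
    using r unfolding insert_iff empty_iff prod.inject by metis
qed

section \<open>Congruences of p-integral rationals\<close>

lemma p_integers_add:
  assumes "prime p" "x \<in> p_integers p" "y \<in> p_integers p"
  shows "x + y \<in> p_integers p"
proof -
  obtain a b c d where ab: "x = of_int a / of_int b" "\<not> int p dvd b"
    and cd: "y = of_int c / of_int d" "\<not> int p dvd d"
    using assms unfolding p_integers_def by blast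
  have "b \<noteq> 0" "d \<noteq> 0" using ab cd by auto
  then have "x + y = of_int (a * d + c * b) / of_int (b * d)"
    using ab cd by (simp add: field_simps)
  moreover have "\<not> int p dvd b * d"
    using ab cd assms(1) by (simp add: prime_dvd_mult_iff)
  ultimately show ?thesis unfolding p_integers_def by blast
qed

lemma p_integers_of_int: "prime p \<Longrightarrow> of_int a \<in> p_integers p"
  unfolding p_integers_def
  by (intro CollectI exI[of _ a] exI[of _ 1]) (auto dest: not_prime_unit)

lemma rat_cong_add:
  assumes "prime p" "rat_cong p x y" "rat_cong p x' y'"
  shows "rat_cong p (x + x') (y + y')"
proof -
  obtain z z' where "z \<in> p_integers p" "x - y = of_nat p * z"
    "z' \<in> p_integers p" "x' - y' = of_nat p * z'"
    using assms unfolding rat_cong_def by blast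
  then have "z + z' \<in> p_integers p" "x + x' - (y + y') = of_nat p * (z + z')"
    using assms(1) p_integers_add by (simp_all add: algebra_simps)
  then show ?thesis
    using assms p_integers_add unfolding rat_cong_def by blast
qed

text \<open>The passage from integer congruences to rational ones, by clearing a denominator prime
  to \<open>p\<close>.\<close>

lemma rat_cong_fractionI:
  assumes "prime p" "\<not> int p dvd b" "[a = b * c] (mod int p)"
  shows "rat_cong p (of_int a / of_int b) (of_int c)"
proof -
  obtain k where k: "a - b * c = int p * k"
    using assms(3) by (auto simp: cong_iff_dvd_diff)
  have "b \<noteq> 0" using assms(2) by auto
  have "of_int a - of_int b * of_int c = (of_nat p * of_int k :: rat)"
    by (metis k of_int_diff of_int_mult of_int_of_nat_eq)
  then have "of_int a / of_int b - of_int c = of_nat p * (of_int k / of_int b :: rat)"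
    using \<open>b \<noteq> 0\<close> by (simp add: field_simps)
  moreover have "of_int t / of_int b \<in> p_integers p" for t
    using assms(2) unfolding p_integers_def by blast
  ultimately show ?thesis
    using p_integers_of_int[OF assms(1)] unfolding rat_cong_def by blast
qed

lemma rat_cong_of_int_cong:
  assumes "prime p" "rat_cong p x (of_int c)" "[c = d] (mod int p)"
  shows "rat_cong p x (of_int d)"
proof -
  have "rat_cong p (of_int 0 / of_int 1) (of_int (d - c))"
    using assms(1,3)
    by (intro rat_cong_fractionI) (auto dest: not_prime_unit simp: cong_iff_dvd_diff)
  from rat_cong_add[OF assms(1,2) this] show ?thesis by simp
qed

lemma rat_cong_sum:
  assumes "prime p" "finite I" "\<And>i. i \<in> I \<Longrightarrow> rat_cong p (f i) (of_int (g i))"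
  shows "rat_cong p (\<Sum>i\<in>I. f i) (of_int (\<Sum>i\<in>I. g i))"
  using assms(2,3)
proof (induction I rule: finite_induct)
  case empty
  show ?case
    using rat_cong_fractionI[of p 1 0 0] prime_gt_1_nat[OF assms(1)] assms(1) by auto
next
  case (insert i I)
  then show ?case
    using rat_cong_add[OF assms(1)] by auto
qed

section \<open>Central binomial coefficients and the two sums modulo p\<close>

text \<open>The ratio of consecutive central binomial coefficients, cleared of division for the
  induction below.\<close>

lemma Suc_times_central_binomial:
  "Suc j * ((2 * Suc j) choose Suc j) = 2 * (2 * j + 1) * ((2 * j) choose j)"
proof -
  have a: "Suc j * ((2 * Suc j) choose Suc j) = 2 * Suc j * (Suc (2 * j) choose j)"
    using Suc_times_binomial[of j "Suc (2 * j)"] by simp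
  have b: "Suc j * (Suc (2 * j) choose j) = Suc (2 * j) * (2 * j choose j)"
    using Suc_times_binomial_add[of j j] Suc_times_binomial[of j "2 * j"] by (simp add: mult_2)
  have "Suc j * ((2 * Suc j) choose Suc j) = 2 * (Suc j * (Suc (2 * j) choose j))"
    using a by (simp only: mult.assoc)
  then show ?thesis unfolding b by (simp only: mult.assoc Suc_eq_plus1)
qed

text \<open>This is \<open>(2j choose j) = (-4)^j (-1/2 choose j)\<close> with \<open>-1/2\<close> replaced by the
  integer \<open>(p - 1)/2\<close>, which is congruent to it.\<close>

lemma central_binomial_cong:
  fixes p n j :: nat
  assumes "prime p" "p = 2 * n + 1" "j \<le> n"
  shows "[int ((2 * j) choose j) = (- 4) ^ j * int (n choose j)] (mod int p)"
  using assms(3)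
proof (induction j)
  case 0
  show ?case by simp
next
  case (Suc j)
  let ?c = "int ((2 * j) choose j)" and ?b = "int (n choose j)"
  have c: "int (Suc j) * int ((2 * Suc j) choose Suc j) = 2 * (2 * int j + 1) * ?c"
    using arg_cong[OF Suc_times_central_binomial[of j], of int]
    by (simp only: of_nat_mult of_nat_add of_nat_1 of_nat_numeral)
  have "Suc j * (n choose Suc j) = (n - j) * (n choose j)"
    using binomial_absorb_comp[of n j] binomial_absorption[of j n] by simp
  from arg_cong[OF this, of int]
  have b: "int (Suc j) * int (n choose Suc j) = (int n - int j) * ?b"
    using Suc.prems by (simp only: of_nat_mult of_nat_diff Suc_leD)
  have "[2 * (2 * int j + 1) * ?c = 2 * (2 * int j + 1) * ((- 4) ^ j * ?b)] (mod int p)"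
    using Suc by (intro cong_mult cong_refl) simp
  \<comment> \<open>2(2j + 1) + 4(n - j) = 2(2n + 1) = 2p yields the cofactor.\<close>
  also have "[2 * (2 * int j + 1) * ((- 4) ^ j * ?b)
      = (- 4) ^ Suc j * ((int n - int j) * ?b)] (mod int p)"
    unfolding cong_iff_dvd_diff assms(2)
    by (rule dvdI[of _ _ "2 * ((- 4) ^ j * ?b)"]) (simp add: algebra_simps)
  also have "(- 4) ^ Suc j * ((int n - int j) * ?b)
      = int (Suc j) * ((- 4) ^ Suc j * int (n choose Suc j))"
    by (metis b mult.left_commute)
  finally have "[int (Suc j) * int ((2 * Suc j) choose Suc j)
      = int (Suc j) * ((- 4) ^ Suc j * int (n choose Suc j))] (mod int p)"
    using c by simp
  moreover have "\<not> p dvd Suc j"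
    using Suc.prems assms(2) by (intro nat_dvd_not_less) auto
  then have "coprime (int (Suc j)) (int p)"
    using assms(1) by (simp only: coprime_int_iff) (metis coprime_commute prime_imp_coprime)
  ultimately show ?case
    using cong_mult_lcancel by blast
qed

text \<open>16^k / (-4)^k = (-1)^k 2^(2k), so the terms are those of Re (1 + 2i)^n.\<close>

lemma binomial_sum_neg4_cong:
  fixes p n :: nat
  assumes "prime p" "p > 2" "p = 2 * n + 1"
  shows "rat_cong p (\<Sum>k=0..p div 4. of_nat ((4 * k) choose (2 * k)) / (- 4) ^ k)
    (of_int (gauss_re 1 2 n))"
proof -
  have n: "p div 4 = n div 2" unfolding assms(3) by simp
  show ?thesis
    unfolding gauss_re_eq n
  proof (rule rat_cong_sum[OF assms(1)])
    fix k assume "k \<in> {0..n div 2}"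
    then have "2 * k \<le> n" by auto
    note central_binomial_cong[OF assms(1,3) this]
    also have "(- 4) ^ (2 * k) * int (n choose (2 * k))
        = (- 4) ^ k * (int (n choose (2 * k)) * 2 ^ (2 * k) * 1 ^ (n - 2 * k) * (- 1) ^ k)"
      by (simp add: power_mult flip: power_mult_distrib)
    finally have "[int ((4 * k) choose (2 * k)) = (- 4) ^ k
        * (int (n choose (2 * k)) * 2 ^ (2 * k) * 1 ^ (n - 2 * k) * (- 1) ^ k)] (mod int p)"
      by simp
    moreover have "\<not> int p dvd (- 4) ^ k"
    proof
      assume "int p dvd (- 4) ^ k"
      then have "int p dvd 2 ^ 2"
        using assms(1) prime_dvd_power[of "int p" "- 4" k] by simp
      then have "int p dvd 2" using assms(1) prime_dvd_power[of "int p" 2 2] by simp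
      then show False using assms(2) zdvd_imp_le[of "int p" 2] by simp
    qed
    ultimately show "rat_cong p (of_nat ((4 * k) choose (2 * k)) / (- 4) ^ k)
        (of_int (int (n choose (2 * k)) * 2 ^ (2 * k) * 1 ^ (n - 2 * k) * (- 1) ^ k))"
      using rat_cong_fractionI[OF assms(1)] by fastforce
  qed simp
qed

text \<open>By Fermat 4^n = 2^(p-1) is 1 modulo \<open>p\<close>. Multiplying the terms by 4^n =
  4^(2k) 4^(n-2k) makes them those of Re (4 + 2i)^n, as 16^k 4^(2k) / (-64)^k = (-1)^k
  2^(2k).\<close>

lemma binomial_sum_neg64_cong:
  fixes p n :: nat
  assumes "prime p" "p > 2" "p = 2 * n + 1"
  shows "rat_cong p (\<Sum>k=0..p div 4. of_nat ((4 * k) choose (2 * k)) / (- 64) ^ k)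
    (of_int (gauss_re 4 2 n))"
proof -
  have n: "p div 4 = n div 2" unfolding assms(3) by simp
  have two: "\<not> int p dvd 2"
    using assms(2) zdvd_imp_le[of "int p" 2] by auto
  have "\<not> p dvd 2" using two by (metis of_nat_dvd_iff of_nat_numeral)
  then have "[2 ^ (p - 1) = 1] (mod p)" by (rule fermat_theorem[OF assms(1)])
  then have fermat: "[4 ^ n = (1::int)] (mod int p)"
    using assms(3) by (simp add: power_mult flip: cong_int_iff)
  show ?thesis
    unfolding gauss_re_eq n
  proof (rule rat_cong_sum[OF assms(1)])
    fix k assume "k \<in> {0..n div 2}"
    then have k: "2 * k \<le> n" by auto
    let ?c = "int (n choose (2 * k)) * 2 ^ (2 * k) * 4 ^ (n - 2 * k) * (- 1) ^ k"
    have "[int ((2 * (2 * k)) choose (2 * k)) * 1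
        = (- 4) ^ (2 * k) * int (n choose (2 * k)) * 4 ^ n] (mod int p)"
      by (intro cong_mult central_binomial_cong[OF assms(1,3) k] cong_sym[OF fermat])
    also have "(4::int) ^ n = 4 ^ (2 * k) * 4 ^ (n - 2 * k)"
      using k by (simp flip: power_add)
    also have "(- 4) ^ (2 * k) * int (n choose (2 * k)) * (4 ^ (2 * k) * 4 ^ (n - 2 * k))
        = (- 64) ^ k * ?c"
      by (simp add: power_mult flip: power_mult_distrib)
    finally have "[int ((4 * k) choose (2 * k)) = (- 64) ^ k * ?c] (mod int p)" by simp
    moreover have "\<not> int p dvd (- 64) ^ k"
    proof
      assume "int p dvd (- 64) ^ k"
      then have "int p dvd 2 ^ 6"
        using assms(1) prime_dvd_power[of "int p" "- 64" k] by simp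
      then show False using two assms(1) prime_dvd_power[of "int p" 2 6] by simp
    qed
    ultimately show "rat_cong p (of_nat ((4 * k) choose (2 * k)) / (- 64) ^ k) (of_int ?c)"
      using rat_cong_fractionI[OF assms(1)] by fastforce
  qed simp
qed

section \<open>Evaluation by the residue of p modulo 20\<close>

theorem theorem2p5:
  fixes p :: nat
  assumes "prime p" and "p > 5"
  shows
    "(p mod 20 \<in> {1, 3, 7, 9} \<longrightarrow>
        rat_cong p (\<Sum>k=0..p div 4. of_nat ((4 * k) choose (2 * k)) / (- 64) ^ k)
          ((- 1) ^ ((p + 5) div 10) * 5 ^ (p div 4))) \<and>
     (p mod 20 \<in> {11, 19} \<longrightarrow>
        rat_cong p (\<Sum>k=0..p div 4. of_nat ((4 * k) choose (2 * k)) / (- 64) ^ k)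
          (2 * (- 1) ^ ((p + 5) div 10) * 5 ^ ((p - 3) div 4))) \<and>
     (p mod 20 \<in> {13, 17} \<longrightarrow>
        rat_cong p (\<Sum>k=0..p div 4. of_nat ((4 * k) choose (2 * k)) / (- 64) ^ k) 0) \<and>
     (p mod 20 \<in> {1, 9, 11, 19} \<longrightarrow>
        rat_cong p (\<Sum>k=0..p div 4. of_nat ((4 * k) choose (2 * k)) / (- 4) ^ k)
          ((- 1) ^ ((p + 5) div 10) * 5 ^ (p div 4))) \<and>
     (p mod 20 \<in> {3, 7} \<longrightarrow>
        rat_cong p (\<Sum>k=0..p div 4. of_nat ((4 * k) choose (2 * k)) / (- 4) ^ k)
          (- 2 * (- 1) ^ ((p + 5) div 10) * 5 ^ ((p - 3) div 4))) \<and>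
     (p mod 20 \<in> {13, 17} \<longrightarrow>
        rat_cong p (\<Sum>k=0..p div 4. of_nat ((4 * k) choose (2 * k)) / (- 4) ^ k) 0)"
proof -
  define n where "n = p div 2"
  define m where "m = p div 4"
  define S :: rat where "S = (\<Sum>k=0..m. of_nat ((4 * k) choose (2 * k)) / (- 4) ^ k)"
  define T :: rat where "T = (\<Sum>k=0..m. of_nat ((4 * k) choose (2 * k)) / (- 64) ^ k)"
  have p2: "p > 2" using assms(2) by simp
  have n: "p = 2 * n + 1"
    using prime_odd_nat[OF assms(1) p2] unfolding n_def by simp
  have mod4: "p mod 4 = p mod 20 mod 4" by (simp add: mod_mod_cancel)
  have S: "rat_cong p S (of_int (a * 5 ^ m))"
    if "[gauss_re 1 2 n = a * 5 ^ m] (mod int p) \<and> [gauss_im 1 2 n = b * 5 ^ m] (mod int p)" for a b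
    using that unfolding S_def m_def
    by (intro rat_cong_of_int_cong[OF assms(1) binomial_sum_neg4_cong[OF assms(1) p2 n]]) simp
  \<comment> \<open>For p = 3 modulo 4 the second sum is governed by the imaginary part of (1 +
    2i)^n, hence by \<open>b\<close>.\<close>
  have T: "rat_cong p T (of_int (if p mod 4 = 1 then a * 5 ^ m else - b * 5 ^ m))"
    if "[gauss_re 1 2 n = a * 5 ^ m] (mod int p) \<and> [gauss_im 1 2 n = b * 5 ^ m] (mod int p)"
      and "p mod 4 = 1 \<or> p mod 4 = 3" for a b
  proof -
    have "[gauss_re 4 2 n = (if p mod 4 = 1 then a * 5 ^ m else - b * 5 ^ m)] (mod int p)"
      using that gauss_re_4_2_cong[OF assms(1) p2 n]
        cong_minus_minus_iff[of "gauss_im 1 2 n" "b * 5 ^ m" "int p"]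
      by (auto intro: cong_trans)
    then show ?thesis unfolding T_def m_def
      by (rule rat_cong_of_int_cong[OF assms(1) binomial_sum_neg64_cong[OF assms(1) p2 n]])
  qed
  \<comment> \<open>A multiple 20q of 20 in \<open>p\<close> changes the exponent of the sign by the
    even number 2q.\<close>
  have "p + 5 = (p mod 20 + 5) + 2 * (p div 20) * 10"
    using mult_div_mod_eq[of 20 p] by linarith
  then have "(p + 5) div 10 = 2 * (p div 20) + (p mod 20 + 5) div 10"
    by (metis div_mult_self1 zero_neq_numeral)
  then have sign: "(- 1) ^ ((p + 5) div 10) = ((- 1) ^ ((p mod 20 + 5) div 10) :: rat)"
    by (simp add: power_add power_mult)
  \<comment> \<open>Thus both exponents of 5 in the claim are \<open>m\<close>.\<close>
  have m3: "(p - 3) div 4 = m" if "p mod 4 = 3"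
  proof -
    have "p - 3 = 4 * m" using that mult_div_mod_eq[of 4 p] unfolding m_def by linarith
    then show ?thesis by simp
  qed
  note c = gauss_1_2_cong_mod_20[OF assms n, folded m_def]
  note [simp] = mod4 sign m3
  note folds = m_def[symmetric] S_def[symmetric] T_def[symmetric]
  consider "p mod 20 = 1" | "p mod 20 = 3" | "p mod 20 = 7" | "p mod 20 = 9" | "p mod 20 = 11"
    | "p mod 20 = 13" | "p mod 20 = 17" | "p mod 20 = 19"
    | "p mod 20 \<notin> {1, 3, 7, 9, 11, 13, 17, 19}" by blast
  then show ?thesis
  proof cases
    case 1 then show ?thesis unfolding folds using S[OF c[of 1 0]] T[OF c[of 1 0]] by simp
  next
    case 2 then show ?thesis unfolding folds using S[OF c[of "- 2" "- 1"]] T[OF c[of "- 2" "- 1"]] by simp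
  next
    case 3 then show ?thesis unfolding folds using S[OF c[of 2 1]] T[OF c[of 2 1]] by simp
  next
    case 4 then show ?thesis unfolding folds using S[OF c[of "- 1" 0]] T[OF c[of "- 1" 0]] by simp
  next
    case 5 then show ?thesis unfolding folds using S[OF c[of "- 1" 2]] T[OF c[of "- 1" 2]] by simp
  next
    case 6 then show ?thesis unfolding folds using S[OF c[of 0 "- 1"]] T[OF c[of 0 "- 1"]] by simp
  next
    case 7 then show ?thesis unfolding folds using S[OF c[of 0 1]] T[OF c[of 0 1]] by simp
  next
    case 8 then show ?thesis unfolding folds using S[OF c[of 1 "- 2"]] T[OF c[of 1 "- 2"]] by simp
  next
    \<comment> \<open>Every premise of the claim fails for these residues.\<close>
    case 9 then show ?thesis by auto
  qed
qed

end
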